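(* Let $p$ be an odd prime and $r$ an even positive integer. Let $m$ and $n$ be positive integers whose base $p$ expansions contain the same non-zero digits (as multisets, i.e. each non-zero digit occurs the same number of times in both expansions). Then $$2^{-m}\cdot A^{r}_{m}\equiv 2^{-n}\cdot A^{r}_{n} \pmod p,$$ where $2^{-1}$ denotes the inverse of $2$ modulo $p$. In particular, $p$ divides $A^r_m$ if and only if $p$ divides $A^r_n$.
   Context: Write $[m]=\{1,2,\ldots,m\}$ (so $[0]=\emptyset$). For a permutation $\pi$ in the symmetric group $\mathfrak{S}_n$, its descent set is $\mathrm{Des}(\pi)=\{i\in[n-1] : \pi_i>\pi_{i+1}\}$. For $S\subseteq[n-1]$, $\beta_n(S)=|\{\pi\in\mathfrak{S}_n : \mathrm{Des}(\pi)=S\}|$. Define $A^r_n=\sum_{S\subseteq[n-1]}\beta_n(S)^r$. *)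

theory Defs
  imports "HOL-Number_Theory.Number_Theory" "HOL-Combinatorics.Permutations"
begin

text \<open>Permutations of \<open>{1..n}\<close> are functions \<open>\<pi> :: nat \<Rightarrow> nat\<close> with \<open>\<pi> permutes {1..n}\<close>.
  For \<open>n = 0\<close> the truncated interval \<open>{1..n - 1}\<close> is empty.\<close>

definition Des :: "nat \<Rightarrow> (nat \<Rightarrow> nat) \<Rightarrow> nat set" where
  "Des n \<pi> = {i \<in> {1..n - 1}. \<pi> i > \<pi> (i + 1)}"

definition beta :: "nat \<Rightarrow> nat set \<Rightarrow> nat" where
  "beta n S = card {\<pi>. \<pi> permutes {1..n} \<and> Des n \<pi> = S}"

definition A :: "nat \<Rightarrow> nat \<Rightarrow> nat" where
  "A r n = (\<Sum>S\<in>Pow {1..n - 1}. beta n S ^ r)"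

definition digit :: "nat \<Rightarrow> nat \<Rightarrow> nat \<Rightarrow> nat" where
  "digit b n i = n div b ^ i mod b"

definition digit_count :: "nat \<Rightarrow> nat \<Rightarrow> nat \<Rightarrow> nat" where
  "digit_count b n d = card {i. digit b n i = d}"

text \<open>Expansions are padded by infinitely many leading zeros, so \<open>digit_count b n d\<close> is only
  meaningful for \<open>d > 0\<close>; there the counted set is finite.\<close>

lemma finite_digit_positions:
  assumes "b \<ge> 2" "d > 0"
  shows "finite {i. digit b n i = d}"
proof (rule finite_subset)
  show "{i. digit b n i = d} \<subseteq> {..<n}"
  proof
    fix i assume i: "i \<in> {i. digit b n i = d}"
    have "b ^ i \<le> n"
    proof (rule ccontr)
      assume "\<not> b ^ i \<le> n"
      then show False using i assms by (simp add: digit_def)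
    qed
    moreover have "i < b ^ i" using assms(1)
      by (intro power_gt_expt) simp
    ultimately show "i \<in> {..<n}" by simp
  qed
qed simp

end

theory Submission
  imports Defs "HOL-Library.Infinite_Set"
begin

text \<open>The number \<open>\<alpha>\<^sub>n(T) = (\<Sum>S \<subseteq> T. \<beta>\<^sub>n(S))\<close> of permutations with descent set inside
  \<open>T = {t\<^sub>1 < \<dots> < t\<^sub>k}\<close> is the product of the binomial coefficients \<open>t\<^bsub>i+1\<^esub> choose t\<^sub>i\<close>, where
  \<open>t\<^bsub>k+1\<^esub> = n\<close>. By Lucas it is nonzero modulo \<open>p\<close> only if \<open>T\<close> is a chain in the set \<open>D\<close> of those
  \<open>t\<close>, \<open>0 < t < n\<close>, whose base \<open>p\<close> digits are bounded by those of \<open>n\<close>. Hence adjoining an element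
  outside \<open>D\<close> to \<open>S\<close> only changes the sign of \<open>\<beta>\<^sub>n(S)\<close> modulo \<open>p\<close>, and for even \<open>r\<close> the sum \<open>A r n\<close> is
  congruent to \<open>2\<close> to the power \<open>n - 1 - card D\<close> times the sum of \<open>\<beta>\<^sub>n(S)\<close> to the power \<open>r\<close> over
  \<open>S \<subseteq> D\<close>. A permutation of digit positions that turns \<open>n\<close> into \<open>m\<close> preserves all binomial
  coefficients modulo \<open>p\<close>, so it identifies these sums for \<open>n\<close> and \<open>m\<close>.\<close>

subsection \<open>Permutations with descents in a given set\<close>

text \<open>Positions are counted from 1, as in \<^const>\<open>Des\<close>: a descent between the list indices \<open>i\<close> and
  \<open>Suc i\<close> is one at position \<open>Suc i\<close>.\<close>

definition ascending_off :: "nat set \<Rightarrow> nat list \<Rightarrow> bool" where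
  "ascending_off T xs \<longleftrightarrow> (\<forall>i. Suc i < length xs \<longrightarrow> Suc i \<notin> T \<longrightarrow> xs ! i < xs ! Suc i)"

text \<open>Words over an arbitrary set of values are needed because cutting off the last increasing
  block leaves an arbitrary subset of \<open>{1..n}\<close>, not an initial segment.\<close>

definition arrangements :: "nat set \<Rightarrow> nat set \<Rightarrow> nat list set" where
  "arrangements X T = {xs. distinct xs \<and> set xs = X \<and> ascending_off T xs}"

lemma ascending_off_empty: "ascending_off {} xs \<longleftrightarrow> sorted_wrt (<) xs"
  by (simp add: ascending_off_def sorted_wrt_iff_nth_Suc_transp)

text \<open>With \<open>length ys\<close> as the largest permitted descent position, the comparison
  across the cut is unconstrained and every later one must be an ascent.\<close>

lemma ascending_off_append:
  assumes "T \<subseteq> {..<length ys}"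
  shows "ascending_off (insert (length ys) T) (ys @ zs)
    \<longleftrightarrow> ascending_off T ys \<and> sorted_wrt (<) zs"
proof
  assume L: "ascending_off (insert (length ys) T) (ys @ zs)"
  have "ys ! i < ys ! Suc i" if "Suc i < length ys" "Suc i \<notin> T" for i
    using L[unfolded ascending_off_def, rule_format, of i] that by (auto simp: nth_append)
  moreover have "zs ! i < zs ! Suc i" if "Suc i < length zs" for i
  proof -
    have "Suc (length ys + i) \<notin> insert (length ys) T" using assms by auto
    then show ?thesis
      using L[unfolded ascending_off_def, rule_format, of "length ys + i"] that
      by (simp add: nth_append)
  qed
  ultimately show "ascending_off T ys \<and> sorted_wrt (<) zs"
    by (simp add: ascending_off_def sorted_wrt_iff_nth_Suc_transp)
next
  assume R: "ascending_off T ys \<and> sorted_wrt (<) zs"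
  show "ascending_off (insert (length ys) T) (ys @ zs)"
    unfolding ascending_off_def
  proof (intro allI impI)
    fix i assume i: "Suc i < length (ys @ zs)" "Suc i \<notin> insert (length ys) T"
    consider "Suc i < length ys" | "i \<ge> length ys" using i by fastforce
    then show "(ys @ zs) ! i < (ys @ zs) ! Suc i"
    proof cases
      case 1
      then show ?thesis using R i by (auto simp: nth_append ascending_off_def)
    next
      case 2
      then have "zs ! (i - length ys) < zs ! Suc (i - length ys)"
        using R i by (simp add: sorted_wrt_iff_nth_Suc_transp)
      then show ?thesis using 2 by (simp add: nth_append Suc_diff_le)
    qed
  qed
qed

lemma arrangements_empty:
  assumes "finite X"
  shows "arrangements X {} = {sorted_list_of_set X}"
proof -
  have "xs = sorted_list_of_set X" if "sorted_wrt (<) xs" "set xs = X" for xs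
    using that assms by (intro strict_sorted_equal) auto
  then show ?thesis using assms by (auto simp: arrangements_def ascending_off_empty)
qed

lemma finite_arrangements:
  assumes "finite X"
  shows "finite (arrangements X T)"
proof (rule finite_subset)
  show "arrangements X T \<subseteq> {xs. set xs \<subseteq> X \<and> length xs = card X}"
    by (auto simp: arrangements_def distinct_card)
qed (simp add: assms finite_lists_length_eq)

text \<open>Only the relative order of the values matters, so an increasing relabelling acts
  bijectively on the words.\<close>

lemma card_arrangements_image:
  assumes "strict_mono_on X h"
  shows "card (arrangements (h ` X) T) = card (arrangements X T)"
proof -
  have inj: "inj_on h X" by (rule strict_mono_on_imp_inj_on[OF assms])
  have less: "h x < h y \<longleftrightarrow> x < y" if "x \<in> X" "y \<in> X" for x y
    using that assms strict_mono_on_less by blast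
  have asc: "ascending_off T (map h xs) \<longleftrightarrow> ascending_off T xs" if "set xs = X" for xs
  proof -
    have "xs ! i \<in> X" if "i < length xs" for i using that \<open>set xs = X\<close> by auto
    then show ?thesis by (auto simp: ascending_off_def less)
  qed
  have "arrangements (h ` X) T = map h ` arrangements X T"
  proof (intro equalityI subsetI)
    fix ys assume "ys \<in> arrangements (h ` X) T"
    then have ys: "distinct ys" "set ys = h ` X" "ascending_off T ys"
      by (auto simp: arrangements_def)
    define xs where "xs = map (inv_into X h) ys"
    have map: "map h xs = ys"
      unfolding xs_def using ys(2) by (auto intro!: map_idI simp: f_inv_into_f)
    have set: "set xs = X"
      unfolding xs_def using ys(2) inj by (auto simp: inv_into_f_f image_image)
    have "distinct xs" using ys(1) map by (metis distinct_map)
    then show "ys \<in> map h ` arrangements X T"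
      using map set asc[OF set] ys by (auto simp: arrangements_def)
  next
    fix ys assume "ys \<in> map h ` arrangements X T"
    then show "ys \<in> arrangements (h ` X) T"
      using inj asc by (auto simp: arrangements_def distinct_map)
  qed
  moreover have "inj_on (map h) (arrangements X T)"
    by (intro inj_on_mapI inj_on_subset[OF inj]) (auto simp: arrangements_def)
  ultimately show ?thesis by (simp add: card_image)
qed

lemma card_arrangements_cong:
  assumes "finite X" "finite Y" "card X = card Y"
  shows "card (arrangements X T) = card (arrangements Y T)"
proof -
  obtain f where f: "bij_betw f {..<card X} X" "strict_mono_on {..<card X} f"
    using ex_bij_betw_strict_mono_card[OF assms(1)] .
  obtain g where g: "bij_betw g {..<card Y} Y" "strict_mono_on {..<card Y} g"
    using ex_bij_betw_strict_mono_card[OF assms(2)] .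
  from card_arrangements_image[OF f(2)] card_arrangements_image[OF g(2)] show ?thesis
    using f(1) g(1) assms(3) by (simp add: bij_betw_def)
qed

text \<open>Choose the set of the first \<open>t\<close> entries; the remaining entries follow in increasing order.\<close>

lemma card_arrangements_insert:
  assumes X: "finite X" and T: "T \<subseteq> {..<t}" and t: "t \<le> card X"
  shows "card (arrangements X (insert t T)) = (card X choose t) * card (arrangements {1..t} T)"
proof -
  define C where "C = {Y. Y \<subseteq> X \<and> card Y = t}"
  have fin: "finite Y" if "Y \<in> C" for Y using that X finite_subset unfolding C_def by blast
  have "bij_betw (take t) (arrangements X (insert t T)) (\<Union>Y\<in>C. arrangements Y T)"
  proof (rule bij_betw_byWitness[where f' = "\<lambda>ys. ys @ sorted_list_of_set (X - set ys)"])
    have split: "length (take t xs) = t \<and> ascending_off T (take t xs) \<and>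
       drop t xs = sorted_list_of_set (X - set (take t xs))"
      if xs: "xs \<in> arrangements X (insert t T)" for xs
    proof -
      have d: "distinct (take t xs @ drop t xs)" "set (take t xs @ drop t xs) = X"
          "ascending_off (insert t T) (take t xs @ drop t xs)"
        using xs by (auto simp: arrangements_def)
      have len: "length (take t xs) = t" using xs t by (auto simp: arrangements_def distinct_card)
      have a: "ascending_off T (take t xs)" "sorted_wrt (<) (drop t xs)"
        using d(3) ascending_off_append[of T "take t xs" "drop t xs"] T len by auto
      have "set (drop t xs) = X - set (take t xs)"
        using d(1) d(2)[symmetric] unfolding distinct_append set_append by blast
      then have "drop t xs = sorted_list_of_set (X - set (take t xs))"
        using a(2) X by (intro strict_sorted_equal) auto
      then show ?thesis using a len by simp
    qed
    show "\<forall>xs\<in>arrangements X (insert t T).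
        take t xs @ sorted_list_of_set (X - set (take t xs)) = xs"
      using split by (metis append_take_drop_id)
    show "\<forall>ys\<in>\<Union>Y\<in>C. arrangements Y T. take t (ys @ sorted_list_of_set (X - set ys)) = ys"
      by (auto simp: C_def arrangements_def distinct_card)
    show "take t ` arrangements X (insert t T) \<subseteq> (\<Union>Y\<in>C. arrangements Y T)"
    proof
      fix ys assume "ys \<in> take t ` arrangements X (insert t T)"
      then obtain xs where xs: "xs \<in> arrangements X (insert t T)" "ys = take t xs" by auto
      have d: "distinct ys" "set ys \<subseteq> X" "length ys = t" "ascending_off T ys"
        using xs split[OF xs(1)] by (auto simp: arrangements_def dest: in_set_takeD)
      then have "set ys \<in> C" by (auto simp: C_def distinct_card)
      moreover have "ys \<in> arrangements (set ys) T" using d by (simp add: arrangements_def)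
      ultimately show "ys \<in> (\<Union>Y\<in>C. arrangements Y T)" by blast
    qed
    show "(\<lambda>ys. ys @ sorted_list_of_set (X - set ys)) ` (\<Union>Y\<in>C. arrangements Y T)
        \<subseteq> arrangements X (insert t T)"
    proof clarify
      fix Y ys assume Y: "Y \<in> C" and ys: "ys \<in> arrangements Y T"
      have "length ys = t" using Y ys by (auto simp: C_def arrangements_def distinct_card)
      then show "ys @ sorted_list_of_set (X - set ys) \<in> arrangements X (insert t T)"
        using Y ys X T ascending_off_append[of T ys "sorted_list_of_set (X - set ys)"]
        by (auto simp: C_def arrangements_def)
    qed
  qed
  then have "card (arrangements X (insert t T)) = card (\<Union>Y\<in>C. arrangements Y T)"
    by (rule bij_betw_same_card)
  also have "\<dots> = (\<Sum>Y\<in>C. card (arrangements Y T))"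
  proof (rule card_UN_disjoint)
    show "finite C" using X by (simp add: C_def)
    show "\<forall>Y\<in>C. finite (arrangements Y T)" using fin finite_arrangements by blast
    show "\<forall>Y\<in>C. \<forall>Z\<in>C. Y \<noteq> Z \<longrightarrow> arrangements Y T \<inter> arrangements Z T = {}"
      unfolding arrangements_def by blast
  qed
  also have "\<dots> = (\<Sum>Y\<in>C. card (arrangements {1..t} T))"
    by (rule sum.cong[OF refl card_arrangements_cong[OF fin]]) (auto simp: C_def)
  also have "\<dots> = (card X choose t) * card (arrangements {1..t} T)"
    using X by (simp add: C_def n_subsets)
  finally show ?thesis .
qed

section \<open>Counts \<open>alpha\<close>: recursion and relation to \<open>beta\<close>\<close>

definition alpha :: "nat \<Rightarrow> nat set \<Rightarrow> nat" where
  "alpha n T = card {\<pi>. \<pi> permutes {1..n} \<and> Des n \<pi> \<subseteq> T}"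

text \<open>A permutation is identified with its one-line notation, which makes the recursion for
  words available.\<close>

lemma alpha_eq_card_arrangements: "alpha n T = card (arrangements {1..n} T)"
proof -
  let ?word = "\<lambda>\<pi>. map \<pi> [1..<Suc n]"
  have asc: "ascending_off T (?word \<pi>) \<longleftrightarrow> Des n \<pi> \<subseteq> T" if \<pi>: "\<pi> permutes {1..n}" for \<pi>
  proof -
    \<comment> \<open>Neighbouring values differ, so a position that is not a descent is a strict
      ascent.\<close>
    have "\<pi> j \<noteq> \<pi> (Suc j)" for j using permutes_inj[OF \<pi>] by (metis injD n_not_Suc_n)
    then have less: "\<pi> j < \<pi> (Suc j) \<longleftrightarrow> \<not> \<pi> j > \<pi> (j + 1)" for j
      using linorder_less_linear[of "\<pi> j" "\<pi> (Suc j)"] by auto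
    have "ascending_off T (?word \<pi>) \<longleftrightarrow>
        (\<forall>i. Suc i < n \<longrightarrow> Suc i \<notin> T \<longrightarrow> \<pi> (Suc i) < \<pi> (Suc (Suc i)))"
      by (simp add: ascending_off_def less_diff_conv del: upt_Suc)
    also have "\<dots> \<longleftrightarrow> (\<forall>j\<in>{1..n - 1}. j \<notin> T \<longrightarrow> \<pi> j < \<pi> (Suc j))"
    proof (intro iffI ballI allI impI)
      fix j assume *: "\<forall>i. Suc i < n \<longrightarrow> Suc i \<notin> T \<longrightarrow> \<pi> (Suc i) < \<pi> (Suc (Suc i))"
        and "j \<in> {1..n - 1}" "j \<notin> T"
      then show "\<pi> j < \<pi> (Suc j)" using *[rule_format, of "j - 1"] by auto
    qed auto
    also have "\<dots> \<longleftrightarrow> Des n \<pi> \<subseteq> T"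
      unfolding less Des_def by blast
    finally show ?thesis .
  qed
  have "bij_betw ?word {\<pi>. \<pi> permutes {1..n} \<and> Des n \<pi> \<subseteq> T} (arrangements {1..n} T)"
  proof (rule bij_betw_imageI)
    show "inj_on ?word {\<pi>. \<pi> permutes {1..n} \<and> Des n \<pi> \<subseteq> T}"
    proof (rule inj_onI)
      fix \<pi> \<rho> assume *: "\<pi> \<in> {\<pi>. \<pi> permutes {1..n} \<and> Des n \<pi> \<subseteq> T}"
        "\<rho> \<in> {\<pi>. \<pi> permutes {1..n} \<and> Des n \<pi> \<subseteq> T}" "?word \<pi> = ?word \<rho>"
      show "\<pi> = \<rho>"
      proof
        fix i
        show "\<pi> i = \<rho> i"
        proof (cases "i \<in> {1..n}")
          case True
          then show ?thesis using *(3) unfolding map_eq_conv by (auto simp del: upt_Suc)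
        next
          case False
          then show ?thesis using *(1,2) by (metis mem_Collect_eq permutes_not_in)
        qed
      qed
    qed
    show "?word ` {\<pi>. \<pi> permutes {1..n} \<and> Des n \<pi> \<subseteq> T} = arrangements {1..n} T"
    proof (intro equalityI subsetI)
      fix xs assume "xs \<in> ?word ` {\<pi>. \<pi> permutes {1..n} \<and> Des n \<pi> \<subseteq> T}"
      then obtain \<pi> where \<pi>: "\<pi> permutes {1..n}" "Des n \<pi> \<subseteq> T" "xs = ?word \<pi>" by auto
      have s: "set [1..<Suc n] = {1..n}" by auto
      have "distinct xs" unfolding \<pi>(3) distinct_map s
        using permutes_inj_on[OF \<pi>(1)] by simp
      moreover have "set xs = {1..n}" unfolding \<pi>(3) set_map s
        by (rule permutes_image[OF \<pi>(1)])
      ultimately show "xs \<in> arrangements {1..n} T"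
        using asc[OF \<pi>(1)] \<pi> by (simp add: arrangements_def)
    next
      fix xs assume "xs \<in> arrangements {1..n} T"
      then have xs: "distinct xs" "set xs = {1..n}" "ascending_off T xs"
        by (auto simp: arrangements_def)
      have len: "length xs = n" using distinct_card[OF xs(1)] xs(2) by simp
      \<comment> \<open>List indices start at 0, hence \<open>i - 1\<close>; outside
        \<open>{1..n}\<close> the map must be the identity to satisfy
        \<open>permutes\<close>.\<close>
      define \<pi> where "\<pi> i = (if i \<in> {1..n} then xs ! (i - 1) else i)" for i
      have word: "?word \<pi> = xs"
        by (rule nth_equalityI) (simp_all add: len \<pi>_def del: upt_Suc)
      have "bij_betw (\<lambda>i. xs ! (i - 1)) {1..n} {1..n}"
      proof -
        have "bij_betw (\<lambda>i. i - 1) {1..n} {..<n}"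
          by (rule bij_betw_byWitness[where f' = Suc]) auto
        moreover have "bij_betw ((!) xs) {..<n} {1..n}"
          using xs len by (intro bij_betw_nth) auto
        ultimately have "bij_betw ((!) xs \<circ> (\<lambda>i. i - 1)) {1..n} {1..n}" by (rule bij_betw_trans)
        then show ?thesis by (simp add: comp_def)
      qed
      then have "bij_betw \<pi> {1..n} {1..n}"
        by (rule bij_betw_cong[THEN iffD1, rotated]) (simp add: \<pi>_def)
      then have "\<pi> permutes {1..n}"
        by (rule bij_imp_permutes) (auto simp: \<pi>_def)
      then show "xs \<in> ?word ` {\<pi>. \<pi> permutes {1..n} \<and> Des n \<pi> \<subseteq> T}"
        using asc[of \<pi>] xs(3) word by (intro image_eqI[of _ _ \<pi>]) (simp_all only: mem_Collect_eq)
    qed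
  qed
  then show ?thesis unfolding alpha_def by (rule bij_betw_same_card)
qed

lemma alpha_empty: "alpha n {} = 1"
  by (simp add: alpha_eq_card_arrangements arrangements_empty)

lemma alpha_insert:
  assumes "T \<subseteq> {..<t}" "t \<le> n"
  shows "alpha n (insert t T) = (n choose t) * alpha t T"
  using card_arrangements_insert[of "{1..n}" T t] assms by (simp add: alpha_eq_card_arrangements)

text \<open>Classify the permutations counted by \<open>alpha\<close> according to their exact
  descent set.\<close>

lemma sum_beta:
  assumes "finite T"
  shows "(\<Sum>S\<in>Pow T. beta n S) = alpha n T"
proof -
  have "{\<pi>. \<pi> permutes {1..n} \<and> Des n \<pi> \<subseteq> T} = (\<Union>S\<in>Pow T. {\<pi>. \<pi> permutes {1..n} \<and> Des n \<pi> = S})"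
    by auto
  moreover have "finite {\<pi>. \<pi> permutes {1..n} \<and> Des n \<pi> = S}" for S
    by (rule finite_subset[OF _ finite_permutations[of "{1..n}"]]) auto
  ultimately show ?thesis unfolding alpha_def beta_def
    using assms by (subst card_UN_disjoint[symmetric]) auto
qed

subsection \<open>Lucas and permutations of digits\<close>

text \<open>Coefficient form of (1 + X)^p = 1 + X^p modulo p: in Vandermonde's sum only the terms
  \<open>j = 0\<close> and \<open>j = p\<close> survive.\<close>

lemma prime_choose_add_cong:
  fixes p x k :: nat
  assumes "prime p"
  shows "[(p + x) choose k = (x choose k) + (if k \<ge> p then x choose (k - p) else 0)] (mod p)"
proof -
  have p: "p > 0" using assms prime_gt_0_nat by blast
  have dvd: "p dvd (p choose j)" if "0 < j" "j < p" for j
    using that assms by (intro dvd_choose_prime) auto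
  have "[(\<Sum>j\<le>k. (p choose j) * (x choose (k - j))) =
      (\<Sum>j\<le>k. (if j = 0 \<or> j = p then x choose (k - j) else 0))] (mod p)"
  proof (rule cong_sum)
    fix j
    show "[(p choose j) * (x choose (k - j)) = (if j = 0 \<or> j = p then x choose (k - j) else 0)] (mod p)"
      using dvd[of j] by (cases j p rule: linorder_cases) (auto simp: cong_0_iff binomial_eq_0)
  qed
  also have "(\<Sum>j\<le>k. (if j = 0 \<or> j = p then x choose (k - j) else 0)) =
      (\<Sum>j\<in>{..k} \<inter> {0, p}. x choose (k - j))"
    by (subst sum.inter_restrict) (auto intro!: sum.cong)
  also have "{..k} \<inter> {0, p} = (if k \<ge> p then {0, p} else {0})" by auto
  also have "(\<Sum>j\<in>\<dots>. x choose (k - j)) = (x choose k) + (if k \<ge> p then x choose (k - p) else 0)"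
    using p by auto
  finally show ?thesis by (simp add: vandermonde)
qed

text \<open>Induction on the quotient \<open>a\<close>: adding \<open>p\<close> to the upper
  argument acts as Pascal's rule on \<open>a choose (k div p)\<close> and leaves the last digit
  alone.\<close>

lemma Lucas_step:
  fixes p a c k :: nat
  assumes "prime p" "c < p"
  shows "[(p * a + c) choose k = (a choose (k div p)) * (c choose (k mod p))] (mod p)"
proof (induction a arbitrary: k)
  case 0
  then show ?case using assms by (cases "k < p") (auto simp: div_greater_zero_iff binomial_eq_0 not_less)
next
  case (Suc a)
  have p: "p > 0" using assms by simp
  have "p * Suc a + c = p + (p * a + c)" by simp
  then have "[(p * Suc a + c) choose k = ((p * a + c) choose k) +
      (if k \<ge> p then (p * a + c) choose (k - p) else 0)] (mod p)"
    using prime_choose_add_cong[OF assms(1)] by presburger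
  also have "[((p * a + c) choose k) + (if k \<ge> p then (p * a + c) choose (k - p) else 0) =
      (a choose (k div p)) * (c choose (k mod p)) +
      (if k \<ge> p then (a choose ((k - p) div p)) * (c choose ((k - p) mod p)) else 0)] (mod p)"
    using Suc.IH by (intro cong_add) auto
  also have "(a choose (k div p)) * (c choose (k mod p)) +
      (if k \<ge> p then (a choose ((k - p) div p)) * (c choose ((k - p) mod p)) else 0)
      = (Suc a choose (k div p)) * (c choose (k mod p))"
  proof (cases "k \<ge> p")
    case True
    then obtain q where "k = q + p" by (metis le_add_diff_inverse2)
    then show ?thesis using p by (simp add: algebra_simps)
  qed simp
  finally show ?case .
qed

lemma digit_0: "digit b n 0 = n mod b"
  by (simp add: digit_def)

lemma digit_Suc: "digit b n (Suc i) = digit b (n div b) i"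
  by (simp add: digit_def div_mult2_eq)

text \<open>Each step splits off the lowest digit. Both numbers are padded to a common length
  \<open>N\<close>, so that one permutation of positions can act on both.\<close>

theorem Lucas:
  fixes p a b :: nat
  assumes "prime p" "a < p ^ N" "b < p ^ N"
  shows "[a choose b = (\<Prod>i<N. digit p a i choose digit p b i)] (mod p)"
  using assms(2,3)
proof (induction N arbitrary: a b)
  case 0
  then show ?case by simp
next
  case (Suc N)
  have p: "p > 0" using assms prime_gt_0_nat by blast
  have "[(p * (a div p) + a mod p) choose b
      = ((a div p) choose (b div p)) * ((a mod p) choose (b mod p))] (mod p)"
    using p by (intro Lucas_step assms) auto
  also have "[((a div p) choose (b div p)) * ((a mod p) choose (b mod p)) =
      (\<Prod>i<N. digit p (a div p) i choose digit p (b div p) i) * ((a mod p) choose (b mod p))] (mod p)"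
    using Suc.prems p
    by (intro cong_mult cong_refl Suc.IH) (auto simp: less_mult_imp_div_less mult.commute)
  also have "(\<Prod>i<N. digit p (a div p) i choose digit p (b div p) i) * ((a mod p) choose (b mod p))
      = (\<Prod>i<Suc N. digit p a i choose digit p b i)"
    by (subst prod.lessThan_Suc_shift) (simp add: digit_0 digit_Suc mult.commute)
  finally show ?case by simp
qed

section \<open>Digit expansions and permutations of digit positions\<close>

lemma sum_digits_less:
  fixes b :: nat
  assumes "\<And>i. i < N \<Longrightarrow> c i < b"
  shows "(\<Sum>i<N. c i * b ^ i) < b ^ N"
  using assms
proof (induction N)
  case (Suc N)
  have "(\<Sum>i<Suc N. c i * b ^ i) < b ^ N + c N * b ^ N" using Suc by simp
  also have "\<dots> = Suc (c N) * b ^ N" by simp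
  also have "\<dots> \<le> b * b ^ N" by (intro mult_right_mono) (use Suc.prems[of N] in auto)
  finally show ?case by simp
qed simp

lemma digit_sum_digits:
  fixes b :: nat
  assumes "\<And>i. i < N \<Longrightarrow> c i < b" "j < N"
  shows "digit b (\<Sum>i<N. c i * b ^ i) j = c j"
  using assms
proof (induction N arbitrary: c j)
  case (Suc N)
  define s where "s = (\<Sum>i<N. c (Suc i) * b ^ i)"
  have b: "c 0 < b" using Suc.prems by simp
  have sum: "(\<Sum>i<Suc N. c i * b ^ i) = c 0 + b * s"
    by (subst sum.lessThan_Suc_shift) (simp add: s_def sum_distrib_left algebra_simps)
  show ?case
  proof (cases j)
    case 0
    then show ?thesis using b by (simp add: sum digit_0 del: sum.lessThan_Suc)
  next
    case (Suc i)
    then have "digit b s i = c (Suc i)"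
      unfolding s_def using Suc.prems by (intro Suc.IH) auto
    then show ?thesis using b Suc by (simp add: sum digit_Suc del: sum.lessThan_Suc)
  qed
qed simp

lemma sum_digits:
  fixes b :: nat
  assumes "n < b ^ N"
  shows "(\<Sum>i<N. digit b n i * b ^ i) = n"
  using assms
proof (induction N arbitrary: n)
  case (Suc N)
  have "n div b < b ^ N" using Suc.prems by (simp add: less_mult_imp_div_less mult.commute)
  then have "(\<Sum>i<N. digit b (n div b) i * b ^ i) = n div b" by (rule Suc.IH)
  then have "(\<Sum>i<N. digit b (n div b) i * b ^ Suc i) = b * (n div b)"
    by (metis (no_types, lifting) mult.left_commute power_Suc sum.cong sum_distrib_left)
  then show ?case by (subst sum.lessThan_Suc_shift) (simp add: digit_0 digit_Suc)
qed simp

lemma digit_less: "b > 0 \<Longrightarrow> digit b n i < b"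
  by (simp add: digit_def)

definition permute_digits :: "nat \<Rightarrow> nat \<Rightarrow> (nat \<Rightarrow> nat) \<Rightarrow> nat \<Rightarrow> nat" where
  "permute_digits b N \<sigma> t = (\<Sum>i<N. digit b t (\<sigma> i) * b ^ i)"

lemma permute_digits_less:
  assumes "b > 0"
  shows "permute_digits b N \<sigma> t < b ^ N"
  unfolding permute_digits_def by (rule sum_digits_less) (simp add: assms digit_less)

lemma digit_permute_digits:
  assumes "b > 0" "i < N"
  shows "digit b (permute_digits b N \<sigma> t) i = digit b t (\<sigma> i)"
  unfolding permute_digits_def by (rule digit_sum_digits) (simp_all add: assms digit_less)

text \<open>Position \<open>i\<close> of the result reads digit \<open>\<sigma> (\<rho> i)\<close>
  of \<open>t\<close>, since digits are pulled back along the permutation.\<close>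

lemma permute_digits_permute_digits:
  assumes "b > 0" "t < b ^ N" "\<And>i. i < N \<Longrightarrow> \<sigma> (\<rho> i) = i" "\<And>i. i < N \<Longrightarrow> \<rho> i < N"
  shows "permute_digits b N \<rho> (permute_digits b N \<sigma> t) = t"
proof -
  have "permute_digits b N \<rho> (permute_digits b N \<sigma> t)
      = (\<Sum>i<N. digit b (permute_digits b N \<sigma> t) (\<rho> i) * b ^ i)"
    by (simp only: permute_digits_def[of b N \<rho>])
  also have "\<dots> = (\<Sum>i<N. digit b t i * b ^ i)"
    using assms by (intro sum.cong) (auto simp: digit_permute_digits)
  also have "\<dots> = t" by (rule sum_digits[OF assms(2)])
  finally show ?thesis .
qed

lemma bij_betw_permute_digits:
  assumes "b > 0" "\<sigma> permutes {..<N}"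
  shows "bij_betw (permute_digits b N \<sigma>) {..<b ^ N} {..<b ^ N}"
proof (rule bij_betw_byWitness[where f' = "permute_digits b N (inv_into UNIV \<sigma>)"])
  have inv: "inv_into UNIV \<sigma> permutes {..<N}" by (rule permutes_inv[OF assms(2)])
  have mem: "\<rho> i < N" if "\<rho> permutes {..<N}" "i < N" for \<rho> i
    using that permutes_in_image by fastforce
  show "\<forall>t\<in>{..<b ^ N}. permute_digits b N (inv_into UNIV \<sigma>) (permute_digits b N \<sigma> t) = t"
    using assms mem[OF inv]
    by (auto intro!: permute_digits_permute_digits simp: permutes_inverses)
  show "\<forall>t\<in>{..<b ^ N}. permute_digits b N \<sigma> (permute_digits b N (inv_into UNIV \<sigma>) t) = t"
    using assms inv mem[OF assms(2)]
    by (auto intro!: permute_digits_permute_digits simp: permutes_inverses)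
qed (use assms permute_digits_less in auto)

text \<open>Lucas gives the same factors for both binomial coefficients, only in a different
  order.\<close>

lemma choose_permute_digits:
  assumes "prime p" "\<sigma> permutes {..<N}" "a < p ^ N" "b < p ^ N"
  shows "[permute_digits p N \<sigma> a choose permute_digits p N \<sigma> b = a choose b] (mod p)"
proof -
  have p: "p > 0" using assms prime_gt_0_nat by blast
  have "[permute_digits p N \<sigma> a choose permute_digits p N \<sigma> b =
      (\<Prod>i<N. digit p (permute_digits p N \<sigma> a) i choose digit p (permute_digits p N \<sigma> b) i)] (mod p)"
    by (intro Lucas assms permute_digits_less p)
  also have "(\<Prod>i<N. digit p (permute_digits p N \<sigma> a) i choose digit p (permute_digits p N \<sigma> b) i)
      = (\<Prod>i<N. digit p a (\<sigma> i) choose digit p b (\<sigma> i))"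
    using p by (intro prod.cong) (auto simp: digit_permute_digits)
  also have "\<dots> = (\<Prod>i<N. digit p a i choose digit p b i)"
    using prod.permute[OF assms(2), of "\<lambda>i. digit p a i choose digit p b i"] by (simp add: comp_def)
  also have "[\<dots> = a choose b] (mod p)"
    by (rule cong_sym, intro Lucas assms)
  finally show ?thesis .
qed

text \<open>Padding to the common length \<open>N\<close> also equalises the numbers of zeros; two
  words with the same multiset of letters differ by a permutation of positions.\<close>

lemma ex_permute_digits:
  assumes b: "b \<ge> 2" and eq: "\<forall>d\<in>{1..b - 1}. digit_count b m d = digit_count b n d"
    and less: "m < b ^ N" "n < b ^ N"
  obtains \<sigma> where "\<sigma> permutes {..<N}" "permute_digits b N \<sigma> n = m"
proof -
  have small: "digit_count b k d = card {i \<in> {..<N}. digit b k i = d}" if "k < b ^ N" "d > 0" for k d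
  proof -
    have "digit b k i = 0" if "i \<ge> N" for i
    proof -
      have "k < b ^ i" using \<open>k < b ^ N\<close> power_increasing[OF that, of b] b by linarith
      then show ?thesis by (simp add: digit_def)
    qed
    then have "{i. digit b k i = d} = {i \<in> {..<N}. digit b k i = d}"
      using \<open>d > 0\<close> by (metis (lifting) lessThan_iff less_not_refl not_less)
    then show ?thesis by (simp add: digit_count_def)
  qed
  have pos: "card {i \<in> {..<N}. digit b m i = d} = card {i \<in> {..<N}. digit b n i = d}" if "d > 0" for d
  proof (cases "d < b")
    case True
    then show ?thesis using small[OF less(1) that] small[OF less(2) that] eq that by auto
  next
    case False
    then have "digit b k i \<noteq> d" for k i using digit_less[of b k i] b by auto
    then show ?thesis by simp
  qed
  \<comment> \<open>The digits at \<open>N\<close> positions number \<open>N\<close> in total, so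
    the counts of the nonzero digits determine the count of zeros.\<close>
  have split: "card {i \<in> {..<N}. digit b k i = 0} + (\<Sum>d\<in>{1..<b}. card {i \<in> {..<N}. digit b k i = d}) = N" for k
  proof -
    have "{..<N} = (\<Union>d<b. {i \<in> {..<N}. digit b k i = d})"
      using digit_less[of b k] b by auto
    then have "card {..<N} = card (\<Union>d<b. {i \<in> {..<N}. digit b k i = d})" by (rule arg_cong)
    also have "\<dots> = (\<Sum>d<b. card {i \<in> {..<N}. digit b k i = d})"
      by (rule card_UN_disjoint) auto
    finally have "(\<Sum>d<b. card {i \<in> {..<N}. digit b k i = d}) = N" by simp
    moreover have "{..<b} = insert 0 {1..<b}" using b by auto
    ultimately show ?thesis by simp
  qed
  have "(\<Sum>d\<in>{1..<b}. card {i \<in> {..<N}. digit b m i = d}) = (\<Sum>d\<in>{1..<b}. card {i \<in> {..<N}. digit b n i = d})"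
    by (rule sum.cong) (use pos in auto)
  then have zero: "card {i \<in> {..<N}. digit b m i = 0} = card {i \<in> {..<N}. digit b n i = 0}"
    using split[of m] split[of n] by linarith
  have "image_mset (digit b m) (mset_set {..<N}) = image_mset (digit b n) (mset_set {..<N})"
  proof (rule multiset_eqI)
    fix d
    have "count (image_mset (digit b k) (mset_set {..<N})) d = card {i \<in> {..<N}. digit b k i = d}" for k
      by (simp add: count_image_mset_eq_card_vimage)
    then show "count (image_mset (digit b m) (mset_set {..<N})) d
        = count (image_mset (digit b n) (mset_set {..<N})) d"
      using pos zero by (cases "d = 0") auto
  qed
  then obtain \<sigma> where \<sigma>: "\<sigma> permutes {..<N}" "\<forall>i\<in>{..<N}. digit b m i = digit b n (\<sigma> i)"
    using image_mset_eq_implies_permutes[of "{..<N}"] by blast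
  have "permute_digits b N \<sigma> n = (\<Sum>i<N. digit b m i * b ^ i)"
    unfolding permute_digits_def using \<sigma>(2) by (intro sum.cong) auto
  also have "\<dots> = m" by (rule sum_digits[OF less(1)])
  finally show ?thesis using that \<sigma>(1) by blast
qed

subsection \<open>Descent statistics modulo a prime\<close>

text \<open>For prime \<open>p\<close>, Lucas identifies these as the \<open>t\<close> strictly
  between 0 and \<open>n\<close> with every digit at most that of \<open>n\<close>. Divisibility is
  the form that the later transport preserves.\<close>

definition dominated :: "nat \<Rightarrow> nat \<Rightarrow> nat set" where
  "dominated p n = {t \<in> {1..n - 1}. \<not> p dvd n choose t}"

lemma dominated_subset: "dominated p n \<subseteq> {1..n - 1}"
  by (auto simp: dominated_def)

lemma finite_dominated [simp]: "finite (dominated p n)"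
  using finite_subset[OF dominated_subset] by blast

text \<open>This is transitivity of domination in contrapositive form; it follows from (n choose
  t)(t choose s) = (n choose s)(n-s choose t-s).\<close>

lemma prime_dvd_choose_trans:
  fixes p :: nat
  assumes "prime p" "s \<le> t" "t \<le> n" "p dvd n choose s"
  shows "p dvd n choose t \<or> p dvd t choose s"
proof -
  have "p dvd (n choose t) * (t choose s)"
    using assms by (simp add: choose_mult)
  then show ?thesis using assms(1) prime_dvd_mult_iff by blast
qed

text \<open>Although \<open>alpha\<close> is a product over consecutive elements only, transitivity
  lets any bad pair \<open>s < t\<close>, adjacent or not, force a factor divisible by
  \<open>p\<close>. The induction removes the maximum of \<open>T\<close>.\<close>

lemma prime_dvd_alpha:
  fixes p :: nat
  assumes "prime p" "T \<subseteq> {..<n}" "s \<in> T" "t \<in> insert n T" "s < t" "p dvd t choose s"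
  shows "p dvd alpha n T"
proof -
  have "finite T" using assms(2) by (rule finite_subset) simp
  then show ?thesis using assms(2-)
  proof (induction T arbitrary: n s t rule: finite_linorder_max_induct)
    case empty
    then show ?case by simp
  next
    case (insert b T)
    have T: "T \<subseteq> {..<b}" using insert.hyps by auto
    have b: "b < n" using insert.prems by auto
    have alpha: "alpha n (insert b T) = (n choose b) * alpha b T"
      using alpha_insert[OF T, of n] b by simp
    consider "s = b" "t = n" | "s \<in> T" "t = n" | "s \<in> T" "t \<in> insert b T"
      using insert.prems T by fastforce
    then show ?case
    proof cases
      case 1
      then show ?thesis using insert.prems alpha by simp
    next
      \<comment> \<open>The maximum \<open>b\<close> lies between \<open>s\<close> and
        \<open>n\<close>, so the divisibility passes to \<open>n choose b\<close> or to
        \<open>b choose s\<close>.\<close>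
      case 2
      then have "s < b" using T by auto
      then have "p dvd n choose b \<or> p dvd b choose s"
        using prime_dvd_choose_trans[OF assms(1), of s b n] b insert.prems 2 by simp
      then show ?thesis
        using insert.IH[OF T \<open>s \<in> T\<close> insertI1 \<open>s < b\<close>] alpha by auto
    next
      case 3
      then show ?thesis using insert.IH[OF T 3 insert.prems(4,5)] alpha by simp
    qed
  qed
qed

text \<open>Since \<open>p\<close> divides \<open>n choose d\<close>, it divides
  \<open>alpha n (insert d S)\<close>. That number is the sum over \<open>T \<subseteq> S\<close> of
  \<open>beta n T + beta n (insert d T)\<close>; by induction all pairs with
  \<open>T \<noteq> S\<close> vanish modulo \<open>p\<close>, hence so does the last one.\<close>

lemma beta_insert_cong:
  fixes p :: nat
  assumes "prime p" and d: "d \<in> {1..n - 1} - dominated p n"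
    and S: "S \<subseteq> {1..n - 1}" "d \<notin> S"
  shows "[int (beta n (insert d S)) = - int (beta n S)] (mod int p)"
proof -
  have "finite S" using S by (auto intro: finite_subset)
  then have "p dvd beta n S + beta n (insert d S)" using S
  proof (induction S rule: finite_psubset_induct)
    case (psubset S)
    have inj: "inj_on (insert d) (Pow S)" using psubset.prems(2) by (auto simp: inj_on_def)
    have "{1..n - 1} \<subseteq> {..<n}" by auto
    then have "insert d S \<subseteq> {..<n}" using psubset.prems(1) d by blast
    then have "p dvd alpha n (insert d S)"
      by (rule prime_dvd_alpha[OF assms(1), where s = d and t = n])
        (use d in \<open>auto simp: dominated_def\<close>)
    also have "alpha n (insert d S) = (\<Sum>T\<in>Pow S. beta n T) + (\<Sum>T\<in>insert d ` Pow S. beta n T)"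
      unfolding sum_beta[symmetric, OF finite.insertI, OF psubset.hyps(1)] Pow_insert
      by (rule sum.union_disjoint) (use psubset.hyps psubset.prems(2) in auto)
    also have "\<dots> = (\<Sum>T\<in>Pow S. beta n T + beta n (insert d T))"
      using inj by (simp add: sum.reindex sum.distrib)
    also have "\<dots> = (beta n S + beta n (insert d S)) +
        (\<Sum>T\<in>Pow S - {S}. beta n T + beta n (insert d T))"
      using psubset.hyps by (intro sum.remove) auto
    finally have sum: "p dvd \<dots>" .
    have "p dvd (\<Sum>T\<in>Pow S - {S}. beta n T + beta n (insert d T))"
      using psubset.prems by (intro dvd_sum psubset.IH) auto
    with sum show ?case by (simp add: dvd_add_left_iff)
  qed
  then have "int p dvd int (beta n S) + int (beta n (insert d S))"
    by (metis int_dvd_int_iff of_nat_add)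
  then show ?thesis by (simp add: cong_iff_dvd_diff add.commute)
qed

text \<open>Subsets with and without a given element of \<open>E\<close> contribute equally, so each
  element of \<open>E\<close> doubles the sum.\<close>

lemma sum_Pow_Un_cong:
  fixes f :: "'a set \<Rightarrow> int"
  assumes "finite E" "finite D" "D \<inter> E = {}"
    and "\<And>e S. e \<in> E \<Longrightarrow> S \<subseteq> D \<union> E \<Longrightarrow> e \<notin> S \<Longrightarrow> [f (insert e S) = f S] (mod q)"
  shows "[(\<Sum>S\<in>Pow (D \<union> E). f S) = 2 ^ card E * (\<Sum>S\<in>Pow D. f S)] (mod q)"
  using assms
proof (induction E rule: finite_induct)
  case empty
  then show ?case by simp
next
  case (insert e E)
  have e: "e \<notin> D \<union> E" using insert by auto
  have "(\<Sum>S\<in>Pow (D \<union> insert e E). f S) = (\<Sum>S\<in>Pow (D \<union> E). f S) + (\<Sum>S\<in>insert e ` Pow (D \<union> E). f S)"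
    unfolding Un_insert_right Pow_insert
    by (rule sum.union_disjoint) (use insert e in auto)
  also have "inj_on (insert e) (Pow (D \<union> E))" using e by (auto simp: inj_on_def)
  then have "(\<Sum>S\<in>insert e ` Pow (D \<union> E). f S) = (\<Sum>S\<in>Pow (D \<union> E). f (insert e S))"
    by (simp add: sum.reindex)
  also have "[(\<Sum>S\<in>Pow (D \<union> E). f S) + (\<Sum>S\<in>Pow (D \<union> E). f (insert e S))
      = (\<Sum>S\<in>Pow (D \<union> E). f S) + (\<Sum>S\<in>Pow (D \<union> E). f S)] (mod q)"
    by (intro cong_add cong_refl cong_sum insert.prems) (use e in auto)
  also have "(\<Sum>S\<in>Pow (D \<union> E). f S) + (\<Sum>S\<in>Pow (D \<union> E). f S) = 2 * (\<Sum>S\<in>Pow (D \<union> E). f S)"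
    by simp
  also have "[\<dots> = 2 * (2 ^ card E * (\<Sum>S\<in>Pow D. f S))] (mod q)"
    by (intro cong_mult cong_refl insert.IH insert.prems) (use insert.prems in auto)
  finally show ?case using insert.hyps by (simp add: mult.assoc)
qed

lemma A_cong:
  fixes p :: nat
  assumes "prime p" "even r"
  shows "[int (A r n) = 2 ^ (n - 1 - card (dominated p n)) *
    (\<Sum>S\<in>Pow (dominated p n). int (beta n S) ^ r)] (mod int p)"
proof -
  let ?D = "dominated p n" and ?E = "{1..n - 1} - dominated p n"
  have U: "?D \<union> ?E = {1..n - 1}" using dominated_subset by blast
  have "[(\<Sum>S\<in>Pow (?D \<union> ?E). int (beta n S) ^ r)
      = 2 ^ card ?E * (\<Sum>S\<in>Pow ?D. int (beta n S) ^ r)] (mod int p)"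
  proof (rule sum_Pow_Un_cong)
    fix e S assume "e \<in> ?E" "S \<subseteq> ?D \<union> ?E" "e \<notin> S"
    \<comment> \<open>The sign change of \<open>beta\<close> disappears in the even power
      \<open>r\<close>.\<close>
    then have "[int (beta n (insert e S)) ^ r = (- int (beta n S)) ^ r] (mod int p)"
      unfolding U by (intro cong_pow beta_insert_cong assms)
    then show "[int (beta n (insert e S)) ^ r = int (beta n S) ^ r] (mod int p)"
      using assms(2) by simp
  qed auto
  moreover have "card ?E = n - 1 - card ?D"
    using dominated_subset[of p n] by (simp add: card_Diff_subset)
  ultimately show ?thesis unfolding U by (simp add: A_def)
qed

subsection \<open>Transport along maps preserving binomial coefficients\<close>

text \<open>What the transport needs from a digit permutation on the numbers below
  \<open>P = p ^ N\<close>. Such a map need not respect the order of the naturals.\<close>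

locale choose_automorphism =
  fixes p P :: nat and \<phi> :: "nat \<Rightarrow> nat"
  assumes prime: "prime p"
    and bij: "bij_betw \<phi> {..<P} {..<P}"
    and zero: "\<phi> 0 = 0"
    and choose: "a < P \<Longrightarrow> b < P \<Longrightarrow> [\<phi> a choose \<phi> b = a choose b] (mod p)"
begin

lemma eq_iff: "a < P \<Longrightarrow> b < P \<Longrightarrow> \<phi> a = \<phi> b \<longleftrightarrow> a = b"
  using bij by (auto simp: bij_betw_def inj_on_eq_iff)

lemma dvd_iff: "a < P \<Longrightarrow> b < P \<Longrightarrow> p dvd \<phi> a choose \<phi> b \<longleftrightarrow> p dvd a choose b"
  using choose by (rule cong_dvd_iff)

text \<open>Removes the order from the definition: for \<open>t > n\<close> the binomial coefficient
  is 0 and thus divisible by \<open>p\<close>. Every remaining condition is preserved by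
  \<open>\<phi>\<close>.\<close>

lemma mem_dominated_iff:
  assumes "n < P"
  shows "t \<in> dominated p n \<longleftrightarrow> t < P \<and> t \<noteq> 0 \<and> t \<noteq> n \<and> \<not> p dvd n choose t"
proof (cases "t \<le> n")
  case True
  then have "t \<in> {1..n - 1} \<longleftrightarrow> t \<noteq> 0 \<and> t \<noteq> n" by (simp; linarith)
  then show ?thesis using True assms unfolding dominated_def mem_Collect_eq by linarith
next
  case False
  then show ?thesis by (simp add: dominated_def binomial_eq_0)
qed

lemma phi_less: "a < P \<Longrightarrow> \<phi> a < P"
  using bij by (auto simp: bij_betw_def)

lemma image_dominated:
  assumes n: "n < P"
  shows "\<phi> ` dominated p n = dominated p (\<phi> n)"
proof (intro equalityI subsetI)
  fix u assume "u \<in> dominated p (\<phi> n)"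
  then have u: "u < P" "u \<noteq> 0" "u \<noteq> \<phi> n" "\<not> p dvd \<phi> n choose u"
    using mem_dominated_iff[OF phi_less[OF n]] by blast+
  then obtain t where t: "t < P" "u = \<phi> t" using bij by (auto simp: bij_betw_def)
  have "t \<noteq> 0" "t \<noteq> n" using u(2,3) t(2) zero by metis+
  moreover have "\<not> p dvd n choose t" using u(4) dvd_iff[OF n t(1)] t(2) by blast
  ultimately have "t \<in> dominated p n" using t(1) mem_dominated_iff[OF n] by blast
  then show "u \<in> \<phi> ` dominated p n" using t(2) by blast
next
  have P: "0 < P" using n by simp
  fix u assume "u \<in> \<phi> ` dominated p n"
  then obtain t where t: "u = \<phi> t" "t < P" "t \<noteq> 0" "t \<noteq> n" "\<not> p dvd n choose t"
    using mem_dominated_iff[OF n] by blast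
  have "\<phi> t \<noteq> 0" "\<phi> t \<noteq> \<phi> n" using eq_iff[OF t(2) P] eq_iff[OF t(2) n] zero t(3,4) by simp_all
  moreover have "\<not> p dvd \<phi> n choose \<phi> t" using t(5) dvd_iff[OF n t(2)] by blast
  ultimately show "u \<in> dominated p (\<phi> n)"
    using t(1) mem_dominated_iff[OF phi_less[OF n]] phi_less[OF t(2)] by blast
qed

text \<open>Induction on the maximum \<open>b\<close> of the set: on chains the factors correspond
  one by one under \<open>\<phi>\<close>.\<close>

lemma alpha_cong:
  assumes "n < P" "T \<subseteq> dominated p n"
  shows "[alpha (\<phi> n) (\<phi> ` T) = alpha n T] (mod p)"
proof -
  have "finite T" using assms(2) by (rule finite_subset) simp
  then show ?thesis using assms
  proof (induction T arbitrary: n rule: finite_linorder_max_induct)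
    case empty
    then show ?case by (simp add: alpha_empty)
  next
    case (insert b T)
    have T: "T \<subseteq> {..<b}" using insert.hyps by auto
    have D: "insert b T \<subseteq> {..<n}" using insert.prems(2) by (auto simp: dominated_def)
    then have b: "b < n" "b < P" using insert.prems by auto
    have "\<phi> ` insert b T \<subseteq> dominated p (\<phi> n)"
      using insert.prems image_dominated by blast
    then have D': "\<phi> ` insert b T \<subseteq> {..<\<phi> n}" by (auto simp: dominated_def)
    show ?case
      \<comment> \<open>\<open>\<phi>\<close> need not be monotone, but if \<open>\<phi> b\<close> is not the maximum of the image, both sides vanish.\<close>
    proof (cases "T \<subseteq> dominated p b")
      case True
      then have "\<phi> ` T \<subseteq> dominated p (\<phi> b)" using image_dominated[OF b(2)] by blast
      then have T': "\<phi> ` T \<subseteq> {..<\<phi> b}" by (auto simp: dominated_def)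
      have "alpha (\<phi> n) (\<phi> ` insert b T) = (\<phi> n choose \<phi> b) * alpha (\<phi> b) (\<phi> ` T)"
        using alpha_insert[OF T', of "\<phi> n"] D' by auto
      also have "[\<dots> = (n choose b) * alpha b T] (mod p)"
        by (intro cong_mult choose insert.IH insert.prems b True)
      also have "(n choose b) * alpha b T = alpha n (insert b T)"
        using alpha_insert[OF T, of n] b by simp
      finally show ?thesis .
    next
      case False
      have "0 \<notin> T" using insert.prems(2) by (auto simp: dominated_def)
      then obtain u where u: "u \<in> T" "u < b" "p dvd b choose u"
        using False T mem_dominated_iff[OF b(2)] b by fastforce
      have "p dvd alpha n (insert b T)"
        by (rule prime_dvd_alpha[OF prime D, of u b]) (use u in auto)
      moreover have "p dvd alpha (\<phi> n) (\<phi> ` insert b T)"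
      proof (cases "\<phi> u < \<phi> b")
        case True
        then show ?thesis
          by (intro prime_dvd_alpha[OF prime D', of "\<phi> u" "\<phi> b"]) (use u b dvd_iff in auto)
      next
        case False
        \<comment> \<open>The order of the pair is reversed: \<open>u choose b\<close> is 0 because
          \<open>u < b\<close>, so \<open>p\<close> divides
          \<open>\<phi> u choose \<phi> b\<close>.\<close>
        then have "\<phi> b < \<phi> u" using eq_iff[of b u] u b by linarith
        then show ?thesis
          by (intro prime_dvd_alpha[OF prime D', of "\<phi> b" "\<phi> u"])
            (use u b dvd_iff in \<open>auto simp: binomial_eq_0\<close>)
      qed
      ultimately show ?thesis by (metis cong_0_iff cong_sym cong_trans)
    qed
  qed
qed

text \<open>Moebius inversion by induction: \<open>beta\<close> at \<open>U\<close> is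
  \<open>alpha\<close> at \<open>U\<close> minus the values of \<open>beta\<close> at the proper
  subsets, and all of these are transported.\<close>

lemma beta_cong:
  assumes n: "n < P" and "U \<subseteq> dominated p n"
  shows "[int (beta (\<phi> n) (\<phi> ` U)) = int (beta n U)] (mod int p)"
proof -
  have "finite U" using assms(2) by (rule finite_subset) simp
  then show ?thesis using assms(2)
  proof (induction U rule: finite_psubset_induct)
    case (psubset U)
    have inj: "inj_on \<phi> U"
      using psubset.prems mem_dominated_iff[OF n] eq_iff by (intro inj_onI) blast
    \<comment> \<open>A general \<open>h\<close> covers both sides of the congruence, with
      \<open>h = \<phi>\<close> and with \<open>h\<close> the identity.\<close>
    have sum: "(\<Sum>S\<in>Pow U. int (beta k (h ` S))) = int (alpha k (h ` U))" if "inj_on h U" for k h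
    proof -
      have "(\<Sum>S\<in>Pow U. beta k (h ` S)) = (\<Sum>S\<in>Pow (h ` U). beta k S)"
        by (rule sum.reindex_bij_betw[OF bij_betw_Pow]) (use that in \<open>simp add: bij_betw_def\<close>)
      also have "\<dots> = alpha k (h ` U)" using psubset.hyps by (simp add: sum_beta)
      finally show ?thesis by (metis of_nat_sum)
    qed
    have rem: "int (beta k (h ` U)) = int (alpha k (h ` U)) - (\<Sum>S\<in>Pow U - {U}. int (beta k (h ` S)))"
      if "inj_on h U" for k h
      using sum[OF that, of k] sum.remove[of "Pow U" U "\<lambda>S. int (beta k (h ` S))"] psubset.hyps
      by simp
    have "[int (alpha (\<phi> n) (\<phi> ` U)) - (\<Sum>S\<in>Pow U - {U}. int (beta (\<phi> n) (\<phi> ` S)))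
        = int (alpha n U) - (\<Sum>S\<in>Pow U - {U}. int (beta n S))] (mod int p)"
      using psubset.prems alpha_cong[OF n psubset.prems]
      by (intro cong_diff cong_sum psubset.IH) (auto simp: cong_int_iff)
    then show ?case using rem[OF inj, of "\<phi> n"] rem[of "\<lambda>x. x" n] by simp
  qed
qed

lemma sum_beta_pow_cong:
  assumes n: "n < P"
  shows "[(\<Sum>S\<in>Pow (dominated p (\<phi> n)). int (beta (\<phi> n) S) ^ r)
    = (\<Sum>S\<in>Pow (dominated p n). int (beta n S) ^ r)] (mod int p)"
    and "card (dominated p (\<phi> n)) = card (dominated p n)"
proof -
  have "inj_on \<phi> (dominated p n)"
    using mem_dominated_iff[OF n] eq_iff by (intro inj_onI) blast
  then have b: "bij_betw \<phi> (dominated p n) (dominated p (\<phi> n))"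
    using image_dominated[OF n] by (simp add: bij_betw_def)
  then show "card (dominated p (\<phi> n)) = card (dominated p n)"
    by (simp add: bij_betw_same_card)
  have "(\<Sum>S\<in>Pow (dominated p (\<phi> n)). int (beta (\<phi> n) S) ^ r)
      = (\<Sum>S\<in>Pow (dominated p n). int (beta (\<phi> n) (\<phi> ` S)) ^ r)"
    by (rule sum.reindex_bij_betw[OF bij_betw_Pow[OF b], symmetric])
  also have "[\<dots> = (\<Sum>S\<in>Pow (dominated p n). int (beta n S) ^ r)] (mod int p)"
    by (intro cong_sum cong_pow beta_cong n) auto
  finally show "[(\<Sum>S\<in>Pow (dominated p (\<phi> n)). int (beta (\<phi> n) S) ^ r)
    = (\<Sum>S\<in>Pow (dominated p n). int (beta n S) ^ r)] (mod int p)" .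
qed

end

section \<open>Normalisation by powers of the inverse of 2, and conclusion\<close>

lemma choose_automorphism_permute_digits:
  assumes "prime p" "\<sigma> permutes {..<N}"
  shows "choose_automorphism p (p ^ N) (permute_digits p N \<sigma>)"
proof
  show "permute_digits p N \<sigma> 0 = 0" by (simp add: permute_digits_def digit_def)
  show "bij_betw (permute_digits p N \<sigma>) {..<p ^ N} {..<p ^ N}"
    by (rule bij_betw_permute_digits[OF prime_gt_0_nat[OF assms(1)] assms(2)])
  show "[permute_digits p N \<sigma> a choose permute_digits p N \<sigma> b = a choose b] (mod p)"
    if "a < p ^ N" "b < p ^ N" for a b
    by (rule choose_permute_digits[OF assms that])
qed (rule assms(1))

text \<open>Of the \<open>n\<close> factors \<open>h\<close>,
  \<open>n - 1 - card (dominated p n)\<close> cancel the power of 2 from \<open>A_cong\<close>. The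
  rest involves only \<open>dominated p n\<close> and \<open>beta\<close> on its subsets, which is
  invariant under the transport.\<close>

lemma normalized_A_cong:
  fixes p :: nat
  assumes "prime p" "even r" "n > 0" and half: "[2 * h = 1] (mod int p)"
  shows "[h ^ n * int (A r n) = h ^ Suc (card (dominated p n)) *
    (\<Sum>S\<in>Pow (dominated p n). int (beta n S) ^ r)] (mod int p)"
proof -
  let ?k = "card (dominated p n)"
  let ?B = "\<Sum>S\<in>Pow (dominated p n). int (beta n S) ^ r"
  have "?k \<le> n - 1" using card_mono[OF _ dominated_subset, of n p] by simp
  then have "n = Suc ?k + (n - 1 - ?k)" using assms(3) by linarith
  then have hn: "h ^ n = h ^ Suc ?k * h ^ (n - 1 - ?k)"
    by (rule trans[OF arg_cong[of _ _ "(^) h"] power_add])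
  have "[h ^ n * int (A r n) = h ^ n * (2 ^ (n - 1 - ?k) * ?B)] (mod int p)"
    by (intro cong_mult cong_refl A_cong assms)
  also have "h ^ n * (2 ^ (n - 1 - ?k) * ?B) = (2 * h) ^ (n - 1 - ?k) * (h ^ Suc ?k * ?B)"
    unfolding hn by (simp add: power_mult_distrib mult_ac)
  also have "[\<dots> = 1 ^ (n - 1 - ?k) * (h ^ Suc ?k * ?B)] (mod int p)"
    by (intro cong_mult cong_pow cong_refl half)
  finally show ?thesis by simp
qed

theorem theorem3p2:
  fixes p r m n :: nat
  assumes "prime p" and "odd p"
    and "even r" and "r > 0"
    and "m > 0" and "n > 0"
    and "\<forall>d\<in>{1..p - 1}. digit_count p m d = digit_count p n d"
  shows "[modular_inverse (int p) 2 ^ m * int (A r m)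
           = modular_inverse (int p) 2 ^ n * int (A r n)] (mod int p)
         \<and> (p dvd A r m \<longleftrightarrow> p dvd A r n)"
proof -
  define h where "h = modular_inverse (int p) 2"
  have coprime: "coprime 2 (int p)" using assms(2) by simp
  have half: "[2 * h = 1] (mod int p)"
    unfolding h_def by (rule cong_modular_inverse1[OF coprime])
  have p: "p \<ge> 2" using assms(1) by (rule prime_ge_2_nat)
  \<comment> \<open>Any common length for both expansions would do; \<open>m + n\<close> works
    because \<open>N < p ^ N\<close>.\<close>
  define N where "N = m + n"
  have "N < p ^ N" using p by (intro power_gt_expt) auto
  then have less: "m < p ^ N" "n < p ^ N" by (simp_all add: N_def)
  obtain \<sigma> where \<sigma>: "\<sigma> permutes {..<N}" "permute_digits p N \<sigma> n = m"
    using ex_permute_digits[OF p assms(7) less] .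
  interpret choose_automorphism p "p ^ N" "permute_digits p N \<sigma>"
    by (rule choose_automorphism_permute_digits[OF assms(1) \<sigma>(1)])
  let ?B = "\<lambda>k. \<Sum>S\<in>Pow (dominated p k). int (beta k S) ^ r"
  have "[h ^ m * int (A r m) = h ^ Suc (card (dominated p m)) * ?B m] (mod int p)"
    by (intro normalized_A_cong assms half)
  also have "[h ^ Suc (card (dominated p m)) * ?B m = h ^ Suc (card (dominated p n)) * ?B n] (mod int p)"
    using sum_beta_pow_cong(1)[OF less(2), of r] sum_beta_pow_cong(2)[OF less(2)]
    unfolding \<sigma>(2) by (simp only: cong_mult cong_refl)
  also have "[h ^ Suc (card (dominated p n)) * ?B n = h ^ n * int (A r n)] (mod int p)"
    by (rule cong_sym) (intro normalized_A_cong assms half)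
  finally have cong: "[h ^ m * int (A r m) = h ^ n * int (A r n)] (mod int p)" .
  \<comment> \<open>Powers of \<open>h\<close> are units modulo \<open>p\<close>, so the congruence
    carries over divisibility of \<open>A\<close> itself.\<close>
  have "coprime (int p) (h ^ k)" for k
    using coprime_modular_inverse[OF coprime] by (simp add: h_def coprime_commute)
  then have "int p dvd h ^ k * int (A r k) \<longleftrightarrow> p dvd A r k" for k
    by (simp add: coprime_dvd_mult_right_iff)
  then show ?thesis using cong cong_dvd_iff[OF cong] unfolding h_def by blast
qed

end
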